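(* Let $n,k$ be positive integers with $k<n$ such that $b := 2n/k$ is an integer, $k/2$ is an integer, and $b\leq k/2$. Then, for every $\varepsilon>0$, the mechanism $\mathrm{Select}_k$ (built from an arbitrary but fixed partition system $\mathcal{S}(n,k)$) is not $(1/b+\varepsilon)$-optimal.
   Context: Write $[n]=\{1,\ldots,n\}$, and let $\mathcal{A}_n$ be the set of $n\times n$ real matrices with non-negative entries and zero diagonal; $A_{ij}$ is the weight of the vote agent $i$ casts for agent $j$. For $R,S\subseteq[n]$ let $\sigma_R(S;A)=\sum_{i\in R,\,j\in S}A_{ij}$, $\sigma(S;A)=\sigma_{[n]}(S;A)$, and write $j$ for $S=\{j\}$; the argument $A$ is omitted when clear. Let $\mathrm{OPT}_k(A)$ be an arbitrary set maximizing $\sigma(S;A)$ among $S\subseteq[n]$ with $|S|=k$. An $(n,k)$-selection mechanism is a function $f\colon\mathcal{A}_n\to 2^{[n]}$ with $|f(A)|\le k$ for all $A$. It is $\alpha$-optimal if $\sigma(f(A);A)\ge\alpha\cdot\sigma(\mathrm{OPT}_k(A);A)$ for all $A\in\mathcal{A}_n$. Partition system: for $n,k$ as in the claim and $b=2n/k$, $\mathcal{S}(n,k)$ denotes an arbitrary but fixed sequence $((S_1^p,S_2^p))_{p\in[k]}$ with $[n]=S_1^p\,\dot\cup\,S_2^p$ (disjoint union) for each $p$, such that (i) $|S_2^p|=b$ for all $p\in[k]$; (ii) $|S_2^p\cap S_2^q|\le1$ for all $p\ne q$; (iii) $|\{p\in[k]: v\in S_2^p\}|=2$ for all $v\in[n]$;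 (iv) for every $U\subseteq[n]$ there is a partition of $U$ into $b$ (possibly empty) disjoint sets $U_1,\ldots,U_b$ such that for all $t\in[b]$, all distinct $u,v\in U_t$ and all $p\in[k]$, $u\in S_2^p$ implies $v\notin S_2^p$; and moreover $S_2^1=[b]$. (Such a sequence exists under the hypotheses on $n,k$.) Mechanism $\mathrm{Select}_k$ on input $A\in\mathcal{A}_n$: for each $j\in[n]$ let $\{l(j),r(j)\}=\{p\in[k]: j\in S_2^p\}$ with $l(j)<r(j)$, and define $\hat\sigma_{S_1^{l(j)}}(j)=\sigma_{S_1^{l(j)}}(j)$ and $\hat\sigma_{S_1^{r(j)}}(j)=\sigma_{S_1^{r(j)}\setminus S_1^{l(j)}}(j)$. For each $p\in[k]$ let $i^p\in S_2^p$ be the agent $j\in S_2^p$ maximizing the pair $(\hat\sigma_{S_1^p}(j),j)$ lexicographically (ties in modified score are broken in favor of the largest index). Output $\{i^p: p\in[k]\}$. *)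

theory Defs
  imports Complex_Main "HOL-Library.Disjoint_Sets"
begin

text \<open>Agents are the naturals \<open>1, \<dots>, n\<close>. An \<open>n \<times> n\<close> matrix is a function of two indices that
  vanishes outside \<open>{1..n} \<times> {1..n}\<close>, so that equality of functions is equality of matrices.\<close>

type_synonym weights = "nat \<Rightarrow> nat \<Rightarrow> real"

definition matrices :: "nat \<Rightarrow> weights set" where
  "matrices n = {A. (\<forall>i\<in>{1..n}. \<forall>j\<in>{1..n}. 0 \<le> A i j) \<and>
                    (\<forall>i\<in>{1..n}. A i i = 0) \<and>
                    (\<forall>i j. i \<notin> {1..n} \<or> j \<notin> {1..n} \<longrightarrow> A i j = 0)}"

definition score_from :: "nat set \<Rightarrow> nat set \<Rightarrow> weights \<Rightarrow> real" where
  "score_from R S A = (\<Sum>i\<in>R. \<Sum>j\<in>S. A i j)"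

definition score :: "nat \<Rightarrow> nat set \<Rightarrow> weights \<Rightarrow> real" where
  "score n S A = score_from {1..n} S A"

definition is_OPT :: "nat \<Rightarrow> nat \<Rightarrow> weights \<Rightarrow> nat set \<Rightarrow> bool" where
  "is_OPT n k A S \<longleftrightarrow>
     S \<subseteq> {1..n} \<and> card S = k \<and>
     (\<forall>T. T \<subseteq> {1..n} \<and> card T = k \<longrightarrow> score n T A \<le> score n S A)"

definition selection_mechanism :: "nat \<Rightarrow> nat \<Rightarrow> (weights \<Rightarrow> nat set) \<Rightarrow> bool" where
  "selection_mechanism n k f \<longleftrightarrow> (\<forall>A\<in>matrices n. f A \<subseteq> {1..n} \<and> card (f A) \<le> k)"

text \<open>All optimal sets have the same score, so quantifying over them is the same as fixing one.\<close>

definition alpha_optimal :: "nat \<Rightarrow> nat \<Rightarrow> real \<Rightarrow> (weights \<Rightarrow> nat set) \<Rightarrow> bool" where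
  "alpha_optimal n k \<alpha> f \<longleftrightarrow>
     (\<forall>A\<in>matrices n. \<forall>S. is_OPT n k A S \<longrightarrow> score n (f A) A \<ge> \<alpha> * score n S A)"

text \<open>The parameter \<open>b\<close> stands for \<open>2n/k\<close>. In the fourth condition the classes \<open>P t\<close> may be empty.\<close>

definition partition_system ::
  "nat \<Rightarrow> nat \<Rightarrow> nat \<Rightarrow> (nat \<Rightarrow> nat set) \<Rightarrow> (nat \<Rightarrow> nat set) \<Rightarrow> bool" where
  "partition_system n k b S1 S2 \<longleftrightarrow>
     (\<forall>p\<in>{1..k}. S1 p \<union> S2 p = {1..n} \<and> S1 p \<inter> S2 p = {}) \<and>
     (\<forall>p\<in>{1..k}. card (S2 p) = b) \<and>
     (\<forall>p\<in>{1..k}. \<forall>q\<in>{1..k}. p \<noteq> q \<longrightarrow> card (S2 p \<inter> S2 q) \<le> 1) \<and>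
     (\<forall>v\<in>{1..n}. card {p\<in>{1..k}. v \<in> S2 p} = 2) \<and>
     (\<forall>U. U \<subseteq> {1..n} \<longrightarrow>
        (\<exists>P :: nat \<Rightarrow> nat set.
           (\<Union>t\<in>{1..b}. P t) = U \<and> disjoint_family_on P {1..b} \<and>
           (\<forall>t\<in>{1..b}. \<forall>u\<in>P t. \<forall>v\<in>P t. u \<noteq> v \<longrightarrow>
              (\<forall>p\<in>{1..k}. u \<in> S2 p \<longrightarrow> v \<notin> S2 p)))) \<and>
     S2 1 = {1..b}"

definition left_group :: "nat \<Rightarrow> (nat \<Rightarrow> nat set) \<Rightarrow> nat \<Rightarrow> nat" where
  "left_group k S2 j = Min {p\<in>{1..k}. j \<in> S2 p}"

definition right_group :: "nat \<Rightarrow> (nat \<Rightarrow> nat set) \<Rightarrow> nat \<Rightarrow> nat" where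
  "right_group k S2 j = Max {p\<in>{1..k}. j \<in> S2 p}"

text \<open>The modified score of \<open>j\<close> in group \<open>p\<close>. It is only used for \<open>j \<in> S2 p\<close>, that is, when \<open>p\<close> is the
  left or the right group of \<open>j\<close>.\<close>

definition mod_score ::
  "nat \<Rightarrow> (nat \<Rightarrow> nat set) \<Rightarrow> (nat \<Rightarrow> nat set) \<Rightarrow> weights \<Rightarrow> nat \<Rightarrow> nat \<Rightarrow> real" where
  "mod_score k S1 S2 A p j =
     (if p = left_group k S2 j
      then score_from (S1 (left_group k S2 j)) {j} A
      else score_from (S1 (right_group k S2 j) - S1 (left_group k S2 j)) {j} A)"

definition winner ::
  "nat \<Rightarrow> (nat \<Rightarrow> nat set) \<Rightarrow> (nat \<Rightarrow> nat set) \<Rightarrow> weights \<Rightarrow> nat \<Rightarrow> nat" where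
  "winner k S1 S2 A p =
     (THE i. i \<in> S2 p \<and>
        (\<forall>j\<in>S2 p. mod_score k S1 S2 A p j < mod_score k S1 S2 A p i \<or>
                  mod_score k S1 S2 A p j = mod_score k S1 S2 A p i \<and> j \<le> i))"

definition Select ::
  "nat \<Rightarrow> (nat \<Rightarrow> nat set) \<Rightarrow> (nat \<Rightarrow> nat set) \<Rightarrow> weights \<Rightarrow> nat set" where
  "Select k S1 S2 A = winner k S1 S2 A ` {1..k}"

lemma lex_max_exists:
  fixes f :: "nat \<Rightarrow> real"
  assumes "finite S" "S \<noteq> {}"
  shows "\<exists>!i. i \<in> S \<and> (\<forall>j\<in>S. f j < f i \<or> f j = f i \<and> j \<le> i)"
proof -
  define M where "M = {i\<in>S. f i = Max (f ` S)}"
  have "Max (f ` S) \<in> f ` S" using assms by simp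
  then have "M \<noteq> {}" unfolding M_def by force
  moreover have "finite M" using assms by (simp add: M_def)
  ultimately have mem: "Max M \<in> M" and ge: "\<And>j. j \<in> M \<Longrightarrow> j \<le> Max M" by auto
  have max: "f j < f (Max M) \<or> f j = f (Max M) \<and> j \<le> Max M" if "j \<in> S" for j
  proof -
    have "f j \<le> Max (f ` S)" using that assms by simp
    then show ?thesis using mem ge[of j] that by (auto simp: M_def)
  qed
  have in_S: "Max M \<in> S" using mem by (simp add: M_def)
  show ?thesis
  proof (rule ex1I[of _ "Max M"])
    show "Max M \<in> S \<and> (\<forall>j\<in>S. f j < f (Max M) \<or> f j = f (Max M) \<and> j \<le> Max M)"
      using in_S max by blast
  next
    fix i assume i: "i \<in> S \<and> (\<forall>j\<in>S. f j < f i \<or> f j = f i \<and> j \<le> i)"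
    then have "f (Max M) < f i \<or> f (Max M) = f i \<and> Max M \<le> i" using in_S by blast
    then show "i = Max M" using max[of i] i by linarith
  qed
qed

lemma winner_in_group:
  assumes "partition_system n k b S1 S2" "0 < b" "p \<in> {1..k}"
  shows "winner k S1 S2 A p \<in> S2 p"
proof -
  have "card (S2 p) = b" using assms by (simp add: partition_system_def)
  then have "finite (S2 p)" "S2 p \<noteq> {}" using assms(2) by (auto intro: card_ge_0_finite)
  from theI'[OF lex_max_exists[OF this]] show ?thesis unfolding winner_def by blast
qed

lemma selection_mechanism_Select:
  assumes "partition_system n k b S1 S2" "0 < b"
  shows "selection_mechanism n k (Select k S1 S2)"
  unfolding selection_mechanism_def
proof (intro ballI conjI)
  fix A
  show "Select k S1 S2 A \<subseteq> {1..n}"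
  proof
    fix i assume "i \<in> Select k S1 S2 A"
    then obtain p where p: "p \<in> {1..k}" and "i = winner k S1 S2 A p"
      unfolding Select_def by blast
    then have "i \<in> S2 p" using winner_in_group[OF assms p] by simp
    moreover have "S1 p \<union> S2 p = {1..n}" 
      using assms(1) p unfolding partition_system_def by meson
    ultimately show "i \<in> {1..n}" by blast
  qed
  show "card (Select k S1 S2 A) \<le> k"
    unfolding Select_def using card_image_le[of "{1..k}"] by simp
qed

end

(* Let a single voter outside S_2^1 = [b] vote for every agent of [b]. Each j in [b] has left group 1,
   so its modified score vanishes in its right group. There all scores are 0, and the tie goes to an
   agent outside [b], because [b] holds the smallest indices and S_2^p meets [b] in at most one agent.
   Hence only group 1 can select from [b], and the mechanism gets 1 out of b. *)
theory Submission imports Defs begin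

text \<open>\<open>winner\<close> is a definite description, so its defining property is available
  only once unique existence is known. \<open>0 < b\<close> makes the group finite and nonempty, as
  \<open>lex_max_exists\<close> requires.\<close>

lemma winner_maximal:
  assumes "partition_system n k b S1 S2" "0 < b" "p \<in> {1..k}" "j \<in> S2 p"
  shows "mod_score k S1 S2 A p j < mod_score k S1 S2 A p (winner k S1 S2 A p) \<or>
    mod_score k S1 S2 A p j = mod_score k S1 S2 A p (winner k S1 S2 A p) \<and>
    j \<le> winner k S1 S2 A p"
proof -
  have "card (S2 p) = b"
    using assms by (simp add: partition_system_def)
  then have "finite (S2 p)" "S2 p \<noteq> {}"
    using assms(2) by (auto intro: card_ge_0_finite)
  from theI'[OF lex_max_exists[OF this]] show ?thesis
    unfolding winner_def using assms(4) by blast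
qed

lemma partition_system_card_inter_le:
  assumes "partition_system n k b S1 S2" "p \<in> {1..k}" "q \<in> {1..k}" "p \<noteq> q"
  shows "card (S2 p \<inter> S2 q) \<le> 1"
  using assms(1)[unfolded partition_system_def, THEN conjunct2, THEN conjunct2, THEN conjunct1]
    assms(2-4) by blast

lemma partition_system_Un:
  assumes "partition_system n k b S1 S2" "p \<in> {1..k}"
  shows "S1 p \<union> S2 p = {1..n}"
  using assms(1)[unfolded partition_system_def, THEN conjunct1] assms(2) by blast

definition star_votes :: "nat \<Rightarrow> nat set \<Rightarrow> weights" where
  "star_votes v T i j = (if i = v \<and> j \<in> T then 1 else 0)"

lemma star_votes_in_matrices:
  assumes "v \<in> {1..n}" "T \<subseteq> {1..n}" "v \<notin> T"
  shows "star_votes v T \<in> matrices n"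
  using assms by (auto simp: matrices_def star_votes_def)

lemma score_from_star_votes_not_mem:
  assumes "v \<notin> R"
  shows "score_from R S (star_votes v T) = 0"
  using assms by (auto simp: score_from_def star_votes_def intro!: sum.neutral)

lemma score_from_star_votes_disjoint:
  assumes "S \<inter> T = {}"
  shows "score_from R S (star_votes v T) = 0"
  using assms by (auto simp: score_from_def star_votes_def intro!: sum.neutral)

lemma score_star_votes:
  assumes "v \<in> {1..n}" "finite S"
  shows "score n S (star_votes v T) = real (card (S \<inter> T))"
proof -
  have "score n S (star_votes v T) = (\<Sum>j\<in>S. \<Sum>i\<in>{1..n}. star_votes v T i j)"
    unfolding score_def score_from_def by (rule sum.swap)
  also have "\<dots> = (\<Sum>j\<in>S. if j \<in> T then 1 else 0)"
    using assms(1) by (intro sum.cong refl) (auto simp: star_votes_def)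
  also have "\<dots> = real (card (S \<inter> T))"
    using assms(2) by (simp add: sum.inter_restrict[symmetric])
  finally show ?thesis .
qed

text \<open>Group 1 carries the least index of all groups, so it is the minimum for each of its
  members.\<close>

lemma left_group_first:
  assumes "1 \<le> k" "j \<in> S2 1"
  shows "left_group k S2 j = 1"
  unfolding left_group_def using assms by (intro Min_eqI) auto

text \<open>For \<open>j\<close> in \<open>S2 1\<close> the score outside group 1 ranges over voters
  with \<open>S1 1\<close> removed, and this discards the only voter \<open>v\<close>. Any other
  \<open>j\<close> receives no vote at all.\<close>

lemma mod_score_star_votes_eq_0:
  assumes "1 \<le> k" "v \<in> S1 1" "p \<noteq> 1"
  shows "mod_score k S1 S2 (star_votes v (S2 1)) p j = 0"
proof (cases "j \<in> S2 1")
  case True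
  then show ?thesis
    using assms left_group_first[OF assms(1), of j S2]
    by (simp add: mod_score_def score_from_star_votes_not_mem)
next
  case False
  then show ?thesis
    by (simp add: mod_score_def score_from_star_votes_disjoint)
qed

lemma winner_star_votes_not_mem:
  assumes ps: "partition_system n k b S1 S2" and "2 \<le> b" "p \<in> {1..k}" "p \<noteq> 1" "v \<in> S1 1"
  shows "winner k S1 S2 (star_votes v (S2 1)) p \<notin> S2 1"
proof
  let ?w = "winner k S1 S2 (star_votes v (S2 1)) p"
  assume w: "?w \<in> S2 1"
  have S2: "S2 1 = {1..b}" "card (S2 p) = b"
    using ps assms(3) by (simp_all add: partition_system_def)
  have inter: "card (S2 p \<inter> S2 1) \<le> 1"
    using partition_system_card_inter_le[OF ps] assms(3,4) by simp
  have "S2 p \<subseteq> {1..n}"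
    using partition_system_Un[OF ps assms(3)] by blast
  \<comment> \<open>Otherwise the intersection would be all of \<open>S2 p\<close>, which has b
    \<ge> 2 elements.\<close>
  have "\<not> S2 p \<subseteq> S2 1"
    using S2(2) inter \<open>2 \<le> b\<close> by (auto simp: Int_absorb2)
  then obtain j where j: "j \<in> S2 p" "j \<notin> S2 1" by blast
  then have "b < j"
    using S2(1) \<open>S2 p \<subseteq> {1..n}\<close> by auto
  \<comment> \<open>Both modified scores are 0, so the strict alternative of maximality fails and
    only the comparison of indices is left.\<close>
  moreover have "j \<le> ?w"
    using winner_maximal[OF ps _ assms(3) j(1), of "star_votes v (S2 1)"] assms
    by (simp add: mod_score_star_votes_eq_0 del: One_nat_def)
  ultimately show False
    using w S2(1) by simp
qed

theorem theorem4p4: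
  fixes n k b :: nat and S1 S2 :: "nat \<Rightarrow> nat set" and \<epsilon> :: real
  assumes "0 < n" and "0 < k" and "k < n"
    and "real b = 2 * real n / real k"
    and "even k"
    and "real b \<le> real k / 2"
    and "partition_system n k b S1 S2"
    and "\<epsilon> > 0"
  shows "\<not> alpha_optimal n k (1 / real b + \<epsilon>) (Select k S1 S2)"
proof
  assume opt: "alpha_optimal n k (1 / real b + \<epsilon>) (Select k S1 S2)"
  note ps = assms(7)
  \<comment> \<open>This is \<open>k < n\<close> inserted into b = 2n/k.\<close>
  have "2 < real b"
    unfolding assms(4) using assms(2,3) by (simp add: field_simps)
  then have b: "2 \<le> b" by simp
  have "b \<le> k"
    using assms(6) by simp
  have S2: "S2 1 = {1..b}"
    using ps by (simp add: partition_system_def)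
  have "S1 1 \<union> S2 1 = {1..n}"
    using \<open>0 < k\<close> by (intro partition_system_Un[OF ps]) simp
  \<comment> \<open>The voter is agent \<open>n\<close>, which lies outside [b] because b \<le> k <
    n.\<close>
  moreover have n: "n \<in> {1..n}" "n \<notin> S2 1"
    using S2 \<open>b \<le> k\<close> \<open>k < n\<close> by auto
  ultimately have "n \<in> S1 1" by blast
  define A where "A = star_votes n (S2 1)"
  have A: "A \<in> matrices n"
    unfolding A_def using n S2 by (intro star_votes_in_matrices) auto
  have score: "score n S A = real (card (S \<inter> {1..b}))" if "finite S" for S
    unfolding A_def using n(1) that S2 by (simp add: score_star_votes)
  \<comment> \<open>Since b \<le> k, the set \<open>{1..k}\<close> contains every agent that
    receives a vote, so it attains the upper bound b shown next.\<close>
  have score_k: "score n {1..k} A = real b"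
    using \<open>b \<le> k\<close> by (simp add: score)
  have "score n T A \<le> real b" if "T \<subseteq> {1..n}" for T
  proof -
    have "card (T \<inter> {1..b}) \<le> card {1..b}"
      by (intro card_mono) auto
    then show ?thesis
      using score[of T] finite_subset[OF that] by simp
  qed
  then have "is_OPT n k A {1..k}"
    using score_k \<open>k < n\<close> by (auto simp: is_OPT_def)
  then have "(1 / real b + \<epsilon>) * real b \<le> score n (Select k S1 S2 A) A"
    using opt A score_k unfolding alpha_optimal_def by metis
  moreover have "Select k S1 S2 A \<inter> {1..b} \<subseteq> {winner k S1 S2 A 1}"
    using winner_star_votes_not_mem[OF ps b _ _ \<open>n \<in> S1 1\<close>]
    unfolding Select_def A_def S2[symmetric] by blast
  then have "card (Select k S1 S2 A \<inter> {1..b}) \<le> 1"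
    using card_mono[of "{winner k S1 S2 A 1}"] by simp
  then have "score n (Select k S1 S2 A) A \<le> 1"
    by (simp add: score Select_def)
  \<comment> \<open>The claimed ratio times the optimum b exceeds 1 by \<epsilon> b > 0, while the
    mechanism scores at most 1.\<close>
  moreover have "(1 / real b + \<epsilon>) * real b = 1 + \<epsilon> * real b"
    using b by (simp add: field_simps)
  ultimately have "1 + \<epsilon> * real b \<le> 1" by linarith
  then show False
    using \<open>\<epsilon> > 0\<close> b by (simp add: mult_le_0_iff)
qed

end
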